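(* Let $X$ be a compact Hausdorff space and let $X/_{\sim}$ be the set of its connected components. Then there exists a topology $\mathscr{T}$ on $X/_{\sim}$, coarser than the quotient topology, such that $(X/_{\sim},\mathscr{T})$ is a profinite space.
   Context: A topological space is profinite if it is compact, Hausdorff and totally disconnected, where totally disconnected means that it has no (nonempty) connected subset other than its points. The quotient topology on $X/_{\sim}$ is the one induced by the canonical projection $\pi:X\to X/_{\sim}$ sending each $x\in X$ to the connected component of $X$ containing $x$. "Coarser" is meant in the non-strict sense (every $\mathscr{T}$-open set is open in the quotient topology). *)

theory Defs
  imports "HOL-Analysis.Analysis"
begin

definition totally_disconnected_space :: "'a topology \<Rightarrow> bool" where
  "totally_disconnected_space X \<longleftrightarrow>
     (\<forall>S. connectedin X S \<and> S \<noteq> {} \<longrightarrow> (\<exists>x. S = {x}))"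

definition profinite_space :: "'a topology \<Rightarrow> bool" where
  "profinite_space X \<longleftrightarrow>
     compact_space X \<and> Hausdorff_space X \<and> totally_disconnected_space X"

definition component_quotient :: "'a topology \<Rightarrow> 'a set topology" where
  "component_quotient X =
     topology (\<lambda>U. U \<subseteq> connected_components_of X \<and>
       openin X {x \<in> topspace X. connected_component_of_set X x \<in> U})"

lemma openin_component_quotient:
  "openin (component_quotient X) U \<longleftrightarrow>
     U \<subseteq> connected_components_of X \<and>
     openin X {x \<in> topspace X. connected_component_of_set X x \<in> U}"
proof -
  let ?P = "\<lambda>U. {x \<in> topspace X. connected_component_of_set X x \<in> U}"
  have "?P (S \<inter> T) = ?P S \<inter> ?P T" for S T by auto
  moreover have "?P (\<Union>\<K>) = (\<Union>K\<in>\<K>. ?P K)" for \<K> by auto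
  ultimately have "istopology (\<lambda>U. U \<subseteq> connected_components_of X \<and> openin X (?P U))"
    unfolding istopology_def by (auto simp: openin_Int intro!: openin_Union)
  then show ?thesis
    by (simp add: component_quotient_def topology_inverse')
qed

lemma topspace_component_quotient:
  "topspace (component_quotient X) = connected_components_of X"
proof -
  have "{x \<in> topspace X. connected_component_of_set X x \<in> connected_components_of X} = topspace X"
    by (auto simp: connected_components_of_def)
  then have "openin (component_quotient X) (connected_components_of X)"
    by (simp add: openin_component_quotient)
  then show ?thesis
    by (meson openin_component_quotient openin_subset openin_topspace subset_antisym)
qed

lemma quotient_map_component_quotient:
  "quotient_map X (component_quotient X) (connected_component_of_set X)"
  by (simp add: quotient_map_def topspace_component_quotient openin_component_quotient
      connected_components_of_def)

end

theory Submission
  imports Defs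
begin

text \<open>The quotient topology itself works. In a compact Hausdorff space components agree with
  quasi-components, so two distinct components are separated by a clopen set; a clopen set is a
  union of components, hence descends to a clopen set of the quotient. Disjoint clopen sets
  separating any two points give both the Hausdorff property and total disconnectedness.\<close>

text \<open>A clopen set contains the whole quasi-component of each of its points, hence also the
  component. So \<open>T\<close> is saturated for the projection.\<close>

lemma connected_component_mem_image_clopenin:
  assumes "closedin X T" "openin X T" "x \<in> topspace X"
  shows "connected_component_of_set X x \<in> connected_component_of_set X ` T \<longleftrightarrow> x \<in> T"
proof
  assume "connected_component_of_set X x \<in> connected_component_of_set X ` T"
  then obtain y where "y \<in> T" "connected_component_of_set X x = connected_component_of_set X y"
    by auto
  then have "connected_component_of X y x"
    using assms(3) by (metis connected_component_of_refl mem_Collect_eq)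
  then have "quasi_component_of X y x"
    by (rule connected_imp_quasi_component_of)
  with \<open>y \<in> T\<close> assms show "x \<in> T"
    by (auto simp: quasi_component_of_def)
qed auto

text \<open>By saturation the preimage of the image of \<open>T\<close> is \<open>T\<close> itself,
  which is open.\<close>

lemma openin_component_quotient_image_clopenin:
  assumes "closedin X T" "openin X T"
  shows "openin (component_quotient X) (connected_component_of_set X ` T)"
proof -
  have "T \<subseteq> topspace X"
    using assms by (simp add: openin_subset)
  then have "{x \<in> topspace X. connected_component_of_set X x \<in> connected_component_of_set X ` T} = T"
    using connected_component_mem_image_clopenin[OF assms] by blast
  with assms \<open>T \<subseteq> topspace X\<close> show ?thesis
    by (auto simp: openin_component_quotient connected_components_of_def)
qed

lemma separated_between_component_quotient:
  assumes "quasi_components_of X = connected_components_of X"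
    and "C \<in> connected_components_of X" "D \<in> connected_components_of X" "C \<noteq> D"
  shows "separated_between (component_quotient X) {C} {D}"
proof -
  let ?f = "connected_component_of_set X"
  obtain x y where x: "x \<in> topspace X" "C = ?f x" and y: "y \<in> topspace X" "D = ?f y"
    using assms by (auto simp: connected_components_of_def)
  \<comment> \<open>The assumed equality turns distinct components into distinct quasi-components,
    and these are told apart by a clopen set.\<close>
  have "\<not> quasi_component_of X x y"
    using assms x y
    by (metis connected_component_of_eq quasi_eq_connected_components_of_pointwise_alt)
  then obtain T where T: "closedin X T" "openin X T" "x \<in> T" "y \<notin> T"
    using x y by (auto simp: quasi_component_of)
  let ?U = "topspace X - T"
  have U: "closedin X ?U" "openin X ?U"
    using T by auto
  note mem = connected_component_mem_image_clopenin[OF T(1,2)]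
  have "openin (component_quotient X) (?f ` T)" "openin (component_quotient X) (?f ` ?U)"
    using openin_component_quotient_image_clopenin T U by blast+
  moreover have "?f ` T \<union> ?f ` ?U = topspace (component_quotient X)"
    using openin_subset[OF T(2)]
    by (auto simp: topspace_component_quotient connected_components_of_def)
  \<comment> \<open>A component in both images would be that of some point of \<open>?U\<close>, and
    saturation would put this point in \<open>T\<close>.\<close>
  moreover have "disjnt (?f ` T) (?f ` ?U)"
    using mem by (auto simp: disjnt_iff)
  moreover have "C \<in> ?f ` T" "D \<in> ?f ` ?U"
    using x y T by auto
  ultimately show ?thesis
    unfolding separated_between_def by blast
qed

text \<open>The two disjoint open sets that witness \<open>separated_between\<close> are the
  required neighbourhoods.\<close>

lemma Hausdorff_space_separated_between:
  assumes "\<And>x y. \<lbrakk>x \<in> topspace X; y \<in> topspace X; x \<noteq> y\<rbrakk> \<Longrightarrow> separated_between X {x} {y}"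
  shows "Hausdorff_space X"
  unfolding Hausdorff_space_def
  using assms by (metis insert_subset separated_between_def)

text \<open>A connected set lies inside a clopen set or misses it, so it cannot contain two points
  that a clopen set separates.\<close>

lemma totally_disconnected_space_separated_between:
  assumes "\<And>x y. \<lbrakk>x \<in> topspace X; y \<in> topspace X; x \<noteq> y\<rbrakk> \<Longrightarrow> separated_between X {x} {y}"
  shows "totally_disconnected_space X"
  unfolding totally_disconnected_space_def
proof (intro allI impI, elim conjE)
  fix S
  assume S: "connectedin X S" "S \<noteq> {}"
  have "x = y" if "x \<in> S" "y \<in> S" for x y
  proof (rule ccontr)
    assume "x \<noteq> y"
    then have "separated_between X {x} {y}"
      using assms that connectedin_subset_topspace[OF S(1)] by blast
    then obtain T where "closedin X T" "openin X T" "x \<in> T" "y \<notin> T"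
      by (auto simp: separated_between)
    then show False
      using connectedin_clopen_cases[OF S(1)] that by (metis disjnt_iff subsetD)
  qed
  with S show "\<exists>x. S = {x}"
    by blast
qed

theorem theorem3p8:
  fixes X :: "'a topology"
  assumes "compact_space X" and "Hausdorff_space X"
  shows "\<exists>\<T> :: 'a set topology.
           topspace \<T> = connected_components_of X \<and>
           (\<forall>U. openin \<T> U \<longrightarrow> openin (component_quotient X) U) \<and>
           profinite_space \<T>"
proof -
  \<comment> \<open>Here the Hausdorff property of \<open>X\<close> enters, together with
    compactness.\<close>
  have "quasi_components_of X = connected_components_of X"
    using assms by (simp add: quasi_eq_connected_components_of)
  then have sep: "separated_between (component_quotient X) {C} {D}"
    if "C \<in> topspace (component_quotient X)" "D \<in> topspace (component_quotient X)" "C \<noteq> D" for C D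
    using that by (simp add: separated_between_component_quotient topspace_component_quotient)
  have "compact_space (component_quotient X)"
    using assms(1) quotient_map_component_quotient[of X]
    by (metis compact_space_def image_compactin quotient_imp_continuous_map
        quotient_imp_surjective_map)
  then have "profinite_space (component_quotient X)"
    using sep by (simp add: profinite_space_def Hausdorff_space_separated_between
        totally_disconnected_space_separated_between)
  \<comment> \<open>Coarser is meant non-strictly, so the witness is
    \<open>component_quotient X\<close> itself.\<close>
  then show ?thesis
    using topspace_component_quotient by blast
qed

end
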